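(* Let $f:\mathbb{R}^d\to[0,\infty)$ be a $C^2$ probability density function with $\|\nabla^2 f\|_\infty<\infty$. Let $X_1,\dots,X_N$ be i.i.d. random variables in $\mathbb{R}^d$ with distribution $\mu(dx)=f(x)\,dx$. Suppose that there is a maximum point $x^*\in\mathbb{R}^d$ of $f$, so that $f^*:=f(x^* )=\sup_{x\in\mathbb{R}^d}f(x)<\infty$. Then for any $p\ge 1$, $$\limsup_{N\to\infty}\left(N^{2/d}\left\|\sup_{n=1,\dots,N}f(X_n)-f^*\right\|_{L^p(\Omega)}\right)\le \frac{\Gamma(\tfrac{2p}{d}+1)^{1/p}\,\Gamma(\tfrac d2+1)^{2/d}\,\kappa_f}{2\pi (f^* )^{2/d}},$$ where $$\kappa_f:=\sup_{|\omega|=1}\sup_{x\in\mathbb{R}^d}\big[-\mathrm{tr}\big((\omega\otimes\omega)\cdot\nabla^2 f(x)\big)\big]\ge 0 .$$ In particular, for $d\ge 2$ and $p=d/2$, $$\limsup_{N\to\infty}\left(N\,\mathbb{E}\left|\sup_{n=1,\dots,N}f(X_n)-f^*\right|^{d/2}\right)\le \left(\frac{\kappa_f}{2\pi}\right)^{d/2}\frac{\Gamma(\tfrac d2+1)}{f^*}.$$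
   Context: $|\cdot|$ is the Euclidean norm on $\mathbb{R}^d$; $\nabla^2 f$ is the Hessian matrix of $f$ and $\|\nabla^2 f\|_\infty$ is its supremum norm over $\mathbb{R}^d$. $\Gamma(\alpha)=\int_0^\infty e^{-s}s^{\alpha-1}\,ds$ is the Gamma function. $\|\cdot\|_{L^p(\Omega)}$ is the $L^p$-norm on the underlying probability space. Note that $\mathrm{tr}((\omega\otimes\omega)\cdot\nabla^2 f(x))=\langle\omega,\nabla^2 f(x)\,\omega\rangle$. *)

theory Defs
  imports "HOL-Probability.Probability"
begin

text \<open>Euclidean space of dimension \<open>d\<close> is \<open>real ^ 'n\<close> with \<open>d = CARD('n)\<close>.\<close>

definition partial_deriv :: "'n::finite \<Rightarrow> (real ^ 'n \<Rightarrow> real) \<Rightarrow> real ^ 'n \<Rightarrow> real" where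
  "partial_deriv i f x = frechet_derivative f (at x) (axis i 1)"

definition C1_fun :: "(real ^ 'n::finite \<Rightarrow> real) \<Rightarrow> bool" where
  "C1_fun f \<longleftrightarrow>
     (\<forall>x. f differentiable (at x)) \<and> (\<forall>i. continuous_on UNIV (partial_deriv i f))"

definition C2_fun :: "(real ^ 'n::finite \<Rightarrow> real) \<Rightarrow> bool" where
  "C2_fun f \<longleftrightarrow> C1_fun f \<and> (\<forall>i. C1_fun (partial_deriv i f))"

definition hessian :: "(real ^ 'n::finite \<Rightarrow> real) \<Rightarrow> real ^ 'n \<Rightarrow> real ^ 'n ^ 'n" where
  "hessian f x = (\<chi> i j. partial_deriv i (partial_deriv j f) x)"

definition outer_prod :: "real ^ 'n::finite \<Rightarrow> real ^ 'n \<Rightarrow> real ^ 'n ^ 'n" where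
  "outer_prod u v = (\<chi> i j. u $ i * v $ j)"

text \<open>The suprema are taken in the reals; they are suprema of sets bounded above
  whenever the Hessian of \<open>f\<close> is bounded.\<close>

definition kappa :: "(real ^ 'n::finite \<Rightarrow> real) \<Rightarrow> real" where
  "kappa f = (SUP \<omega>\<in>{\<omega>. norm \<omega> = 1}. SUP x. - trace (outer_prod \<omega> \<omega> ** hessian f x))"

text \<open>Extended-real valued, because the Bochner integral of a non-integrable function is \<open>0\<close>.\<close>

definition Lp_norm :: "'w measure \<Rightarrow> real \<Rightarrow> ('w \<Rightarrow> real) \<Rightarrow> ereal" where
  "Lp_norm M p Y =
     (if integrable M (\<lambda>\<omega>. \<bar>Y \<omega>\<bar> powr p)
      then ereal ((LINT \<omega>|M. \<bar>Y \<omega>\<bar> powr p) powr (1 / p)) else \<infinity>)"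

end

theory Submission
  imports Defs "HOL-Real_Asymp.Real_Asymp"
begin

text \<open>
  Write \<open>d\<close> for the dimension, \<open>f*\<close> for the maximum, attained at \<open>a\<close>, and \<open>\<kappa>\<close> for \<open>kappa f\<close>.
  The sample maximum misses \<open>f*\<close> by more than \<open>t\<close> only if all sample points avoid the superlevel
  set \<open>{f \<ge> f* - t}\<close>, so the rate is governed by the mass of that set.

  The gradient vanishes at \<open>a\<close>, and \<open>\<kappa>\<close> bounds the downward curvature in every direction;
  hence \<open>f x \<ge> f* - \<kappa>/2 |x - a|\<^sup>2\<close> (\<open>quadratic_lower_bound_at_max\<close>). This forces
  \<open>\<kappa> > 0\<close>, since otherwise \<open>f\<close> would be constant and not integrable (\<open>kappa_pos\<close>), and it shows that the
  superlevel set contains the ball of radius \<open>sqrt (2t/\<kappa>)\<close> about \<open>a\<close>. On that ball \<open>f\<close> is at least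
  \<open>f* - \<delta>\<close> whenever \<open>t \<le> \<delta>\<close>, so its mass is at least \<open>c t\<^bsup>d/2\<^esup>\<close> with
  \<open>c = (f* - \<delta>) V\<^sub>d (2/\<kappa>)\<^bsup>d/2\<^esup>\<close>, where \<open>V\<^sub>d\<close> is the volume of the unit ball
  (\<open>superlevel_ball_mass\<close>). By independence the gap exceeds \<open>t\<close> with probability at most
  \<open>exp (- N c t\<^bsup>d/2\<^esup>)\<close> for \<open>t \<le> \<delta>\<close>, and with exponentially small probability for
  \<open>t > \<delta>\<close>.

  The bound \<open>exp (- N c t\<^bsup>d/2\<^esup>)\<close> is exactly the tail of \<open>(S / (N c))\<^bsup>2/d\<^esup>\<close> with \<open>S\<close> a standard exponential
  variable, whose \<open>p\<close>-th moment is \<open>\<Gamma>(2p/d + 1) (N c)\<^bsup>-2p/d\<^esup>\<close>; comparing the tails of the gap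
  and of this variable through the layer-cake formula bounds the \<open>p\<close>-th moment of the gap
  (\<open>moment_le_of_tail\<close>, \<open>sample_max_gap_moment_le\<close>). After multiplication by \<open>N\<^bsup>2p/d\<^esup>\<close>, letting first \<open>N \<rightarrow> \<infinity>\<close>
  and then \<open>\<delta> \<rightarrow> 0\<close> leaves \<open>\<Gamma>(2p/d + 1) (f* V\<^sub>d (2/\<kappa>)\<^bsup>d/2\<^esup>)\<^bsup>-2p/d\<^esup>\<close>
  (\<open>eventually_moment_le_of_family_bound\<close>). Its \<open>p\<close>-th root is the first bound; the choice \<open>p = d/2\<close>, where
  \<open>\<Gamma>(2) = 1\<close>, gives the second.
\<close>

section \<open>Second-order expansion at a maximum\<close>

lemma frechet_derivative_eq_sum_partial_deriv:
  assumes "f differentiable (at x)"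
  shows "frechet_derivative f (at x) v = (\<Sum>i\<in>UNIV. v $ i * partial_deriv i f x)"
proof -
  have L: "linear (frechet_derivative f (at x))"
    using assms by (rule linear_frechet_derivative)
  have "frechet_derivative f (at x) v = frechet_derivative f (at x) (\<Sum>i\<in>UNIV. v $ i *\<^sub>R axis i 1)"
    using basis_expansion[of v] by (simp add: scalar_mult_eq_scaleR)
  also have "\<dots> = (\<Sum>i\<in>UNIV. v $ i * partial_deriv i f x)"
    by (simp add: linear_sum[OF L] linear_scale[OF L] partial_deriv_def)
  finally show ?thesis .
qed

lemma C1_fun_derivative_along_line:
  assumes "C1_fun f"
  shows "((\<lambda>s. f (x + s *\<^sub>R v)) has_real_derivative
           (\<Sum>i\<in>UNIV. v $ i * partial_deriv i f (x + s *\<^sub>R v))) (at s)"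
proof -
  have D: "f differentiable (at (x + s *\<^sub>R v))"
    using assms by (simp add: C1_fun_def)
  have l: "((\<lambda>s. x + s *\<^sub>R v) has_derivative (\<lambda>h. h *\<^sub>R v)) (at s)"
    by (auto intro!: derivative_eq_intros)
  have "((\<lambda>s. f (x + s *\<^sub>R v)) has_derivative
      (\<lambda>h. frechet_derivative f (at (x + s *\<^sub>R v)) (h *\<^sub>R v))) (at s)"
    using has_derivative_compose[OF l] D by (simp add: frechet_derivative_works)
  then show ?thesis
    by (rule has_derivative_imp_has_field_derivative)
      (simp add: frechet_derivative_eq_sum_partial_deriv[OF D] sum_distrib_left mult_ac)
qed

lemma C1_fun_continuous:
  assumes "C1_fun f" shows "continuous_on UNIV f"
  using assms differentiable_imp_continuous_within
  by (force simp: C1_fun_def intro!: continuous_at_imp_continuous_on)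

text \<open>
  The double sum is written with the order of differentiation that differentiating twice along a
  line produces.
\<close>

lemma trace_outer_prod_hessian:
  "trace (outer_prod v v ** hessian f x) =
     (\<Sum>i\<in>UNIV. \<Sum>j\<in>UNIV. v $ i * (v $ j * partial_deriv j (partial_deriv i f) x))"
  by (simp add: trace_def outer_prod_def matrix_matrix_mult_def hessian_def mult_ac)

lemma C2_fun_second_derivative_along_line:
  assumes "C2_fun f"
  shows "((\<lambda>s. \<Sum>i\<in>UNIV. v $ i * partial_deriv i f (x + s *\<^sub>R v)) has_real_derivative
           trace (outer_prod v v ** hessian f (x + s *\<^sub>R v))) (at s)"
proof -
  have "C1_fun (partial_deriv i f)" for i
    using assms by (simp add: C2_fun_def)
  from C1_fun_derivative_along_line[OF this]
  have "((\<lambda>s. \<Sum>i\<in>UNIV. v $ i * partial_deriv i f (x + s *\<^sub>R v)) has_real_derivative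
     (\<Sum>i\<in>UNIV. v $ i * (\<Sum>j\<in>UNIV. v $ j * partial_deriv j (partial_deriv i f) (x + s *\<^sub>R v)))) (at s)"
    by (intro DERIV_sum DERIV_cmult)
  then show ?thesis
    by (simp add: trace_outer_prod_hessian sum_distrib_left)
qed

text \<open>
  For unit vectors this is the definition of \<open>kappa\<close>; boundedness of the Hessian ensures that both
  nested suprema are taken over sets bounded above, without which a real \<open>SUP\<close> says nothing.
  Homogeneity of degree two extends the bound to all vectors.
\<close>

lemma hessian_form_le_kappa:
  fixes f :: "real ^ 'n::finite \<Rightarrow> real"
  assumes "bounded (range (hessian f))"
  shows "- trace (outer_prod v v ** hessian f x) \<le> kappa f * (norm v)\<^sup>2"
proof -
  obtain B where B: "\<And>x. norm (hessian f x) \<le> B"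
    using assms by (auto simp: bounded_iff)
  \<comment> \<open>Entries of a unit vector are at most 1 in modulus, so each term of the form is at most
    the modulus of a Hessian entry, hence at most \<open>B\<close>.\<close>
  define K where "K = (\<Sum>i\<in>(UNIV::'n set). \<Sum>j\<in>(UNIV::'n set). B)"
  have le_K: "- trace (outer_prod w w ** hessian f y) \<le> K" if "norm w = 1" for w y
  proof -
    have "- trace (outer_prod w w ** hessian f y) \<le>
        (\<Sum>i\<in>UNIV. \<Sum>j\<in>UNIV. \<bar>w $ i * (w $ j * hessian f y $ j $ i)\<bar>)"
      unfolding trace_outer_prod_hessian sum_negf[symmetric]
      by (intro sum_mono) (simp add: hessian_def abs_le_iff)
    also have "\<dots> \<le> K"
      unfolding K_def
    proof (intro sum_mono)
      fix i j :: 'n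
      have w: "\<bar>w $ k\<bar> \<le> 1" for k
        using component_le_norm_cart[of w k] that by simp
      have "\<bar>hessian f y $ j $ i\<bar> \<le> norm (hessian f y $ j)"
        by (rule component_le_norm_cart)
      also have "\<dots> \<le> B"
        using Finite_Cartesian_Product.norm_nth_le[of "hessian f y" j] B[of y] by linarith
      finally have "\<bar>hessian f y $ j $ i\<bar> \<le> B" .
      with mult_mono[OF w[of i] mult_mono[OF w[of j] this]]
      show "\<bar>w $ i * (w $ j * hessian f y $ j $ i)\<bar> \<le> B"
        by (simp add: abs_mult)
    qed
    finally show ?thesis .
  qed
  have unit: "- trace (outer_prod w w ** hessian f y) \<le> kappa f" if w: "norm w = 1" for w y
  proof -
    have "- trace (outer_prod w w ** hessian f y) \<le> (SUP x. - trace (outer_prod w w ** hessian f x))"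
      by (rule cSUP_upper) (use le_K[OF w] in \<open>auto simp: bdd_above_def\<close>)
    also have "\<dots> \<le> kappa f"
      unfolding kappa_def
    proof (rule cSUP_upper)
      show "bdd_above ((\<lambda>w. SUP x. - trace (outer_prod w w ** hessian f x)) ` {w. norm w = 1})"
        by (rule bdd_aboveI2[where M = K]) (auto intro!: cSUP_least le_K)
    qed (use w in simp)
    finally show ?thesis .
  qed
  show ?thesis
  proof (cases "v = 0")
    case True
    then show ?thesis by (simp add: trace_outer_prod_hessian)
  next
    case False
    define w where "w = v /\<^sub>R norm v"
    have v: "v = norm v *\<^sub>R w" and w: "norm w = 1"
      using False by (auto simp: w_def)
    have "trace (outer_prod v v ** hessian f x) = (norm v)\<^sup>2 * trace (outer_prod w w ** hessian f x)"
      unfolding trace_outer_prod_hessian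
      by (subst (1 2) v) (simp add: sum_distrib_left power2_eq_square mult_ac)
    with mult_left_mono[OF unit[OF w, of x], of "(norm v)\<^sup>2"] show ?thesis
      by (simp add: mult_ac)
  qed
qed

text \<open>
  Taylor's formula with Lagrange remainder on the segment from \<open>a\<close> to \<open>x\<close>: the linear term
  vanishes because \<open>a\<close> is a maximum, and the remainder is controlled by \<open>kappa f\<close>.
\<close>

lemma quadratic_lower_bound_at_max:
  fixes f :: "real ^ 'n::finite \<Rightarrow> real"
  assumes C2: "C2_fun f" and bd: "bounded (range (hessian f))"
    and max: "\<And>y. f y \<le> f a"
  shows "f a - kappa f / 2 * (norm (x - a))\<^sup>2 \<le> f x"
proof -
  define v where "v = x - a"
  define g where "g s = f (a + s *\<^sub>R v)" for s
  define g1 where "g1 s = (\<Sum>i\<in>UNIV. v $ i * partial_deriv i f (a + s *\<^sub>R v))" for s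
  define g2 where "g2 s = trace (outer_prod v v ** hessian f (a + s *\<^sub>R v))" for s
  have D1: "(g has_real_derivative g1 s) (at s)" for s
    unfolding g_def g1_def using C2 by (intro C1_fun_derivative_along_line) (simp add: C2_fun_def)
  have D2: "(g1 has_real_derivative g2 s) (at s)" for s
    unfolding g1_def g2_def by (rule C2_fun_second_derivative_along_line[OF C2])
  have g10: "g1 0 = 0"
    by (rule DERIV_local_max[OF D1[of 0], of 1]) (use max in \<open>auto simp: g_def\<close>)
  define D where "D m = (if m = 0 then g else if m = 1 then g1 else g2)" for m :: nat
  have "\<exists>t. 0 < t \<and> t < 1 \<and>
      g 1 = (\<Sum>m<2. D m 0 / fact m * 1 ^ m) + D 2 t / fact 2 * 1 ^ 2"
  proof (rule Maclaurin)
    show "\<forall>m t. m < 2 \<and> 0 \<le> t \<and> t \<le> 1 \<longrightarrow> DERIV (D m) t :> D (Suc m) t"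
      using D1 D2 by (auto simp: D_def less_2_cases_iff)
  qed (auto simp: D_def)
  then obtain t where "g 1 = g 0 + g1 0 + g2 t / 2"
    by (auto simp: D_def numeral_2_eq_2)
  with g10 have "g 1 = g 0 + g2 t / 2" by simp
  moreover have "- g2 t \<le> kappa f * (norm v)\<^sup>2"
    unfolding g2_def by (rule hessian_form_le_kappa[OF bd])
  ultimately show ?thesis
    by (simp add: g_def v_def)
qed

lemma density_max_pos:
  fixes f :: "real ^ 'n::finite \<Rightarrow> real"
  assumes "\<And>x. 0 \<le> f x" "(\<integral>\<^sup>+x. ennreal (f x) \<partial>lborel) = 1" "\<And>x. f x \<le> f a"
  shows "0 < f a"
proof (rule ccontr)
  assume "\<not> 0 < f a"
  then have "f x = 0" for x
    using assms(1)[of x] assms(3)[of x] by linarith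
  with assms(2) show False by simp
qed

text \<open>
  If \<open>kappa f\<close> were nonpositive, the quadratic lower bound would make \<open>f\<close> equal to its maximum
  everywhere, and a positive constant has infinite integral.
\<close>

lemma kappa_pos:
  fixes f :: "real ^ 'n::finite \<Rightarrow> real"
  assumes C2: "C2_fun f" and bd: "bounded (range (hessian f))"
    and max: "\<And>y. f y \<le> f a"
    and density: "\<And>x. 0 \<le> f x" "(\<integral>\<^sup>+x. ennreal (f x) \<partial>lborel) = 1"
  shows "0 < kappa f"
proof (rule ccontr)
  assume "\<not> 0 < kappa f"
  then have np: "kappa f * (norm (x - a))\<^sup>2 \<le> 0" for x
    by (intro mult_nonpos_nonneg) auto
  have "f a \<le> f x" for x
    using quadratic_lower_bound_at_max[OF C2 bd max, of x] np[of x] by simp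
  then have const: "f x = f a" for x
    using max by (rule antisym[rotated])
  have "(\<integral>\<^sup>+x. ennreal (f x) \<partial>lborel) = (\<integral>\<^sup>+x. ennreal (f a) \<partial>(lborel :: (real ^ 'n) measure))"
    by (rule nn_integral_cong) (rule arg_cong[OF const])
  also have "\<dots> = \<infinity>"
    using density_max_pos[of f a] max density by (simp add: ennreal_mult_top)
  finally show False
    using density(2) by simp
qed

text \<open>
  The level \<open>\<delta>\<close> is decoupled from \<open>t\<close> so that the lower bound is a pure power of \<open>t\<close> with a fixed
  coefficient; that coefficient tends to its sharp value as \<open>\<delta> \<rightarrow> 0\<close>.
\<close>

lemma superlevel_ball_mass:
  fixes f :: "real ^ 'n::finite \<Rightarrow> real"
  assumes C2: "C2_fun f" and bd: "bounded (range (hessian f))"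
    and max: "\<And>y. f y \<le> f a"
    and k: "0 < kappa f" and t: "0 \<le> t" "t \<le> \<delta>" "\<delta> \<le> f a"
  defines "r \<equiv> sqrt (2 * t / kappa f)"
  shows "\<And>x. x \<in> cball a r \<Longrightarrow> f a - t \<le> f x"
    and "ennreal ((f a - \<delta>) * unit_ball_vol (real CARD('n)) * (2 / kappa f) powr (real CARD('n) / 2)
            * t powr (real CARD('n) / 2))
          \<le> (\<integral>\<^sup>+x. ennreal (f x) * indicator (cball a r) x \<partial>lborel)"
proof -
  have r: "0 \<le> r" "r\<^sup>2 = 2 * t / kappa f"
    using k t by (auto simp: r_def)
  show low: "f a - t \<le> f x" if "x \<in> cball a r" for x
  proof -
    have "norm (x - a) \<le> r"
      using that by (simp add: dist_norm norm_minus_commute)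
    then have "(norm (x - a))\<^sup>2 \<le> 2 * t / kappa f"
      unfolding r(2)[symmetric] by (intro power_mono) auto
    then have "kappa f / 2 * (norm (x - a))\<^sup>2 \<le> t"
      using k by (simp add: field_simps)
    with quadratic_lower_bound_at_max[OF C2 bd max, of x] show ?thesis by linarith
  qed
  have rd: "r ^ CARD('n) = (2 / kappa f) powr (real CARD('n) / 2) * t powr (real CARD('n) / 2)"
  proof -
    have "r ^ CARD('n) = (2 * t / kappa f) powr (real CARD('n) / 2)"
    proof (cases "t = 0")
      case False
      with r t k have "0 < r" by (simp add: r_def)
      then have "r ^ CARD('n) = r powr (2 * (real CARD('n) / 2))"
        by (simp add: powr_realpow)
      also have "\<dots> = (r powr 2) powr (real CARD('n) / 2)"
        by (rule powr_powr[symmetric])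
      also have "r powr 2 = 2 * t / kappa f"
        using r \<open>0 < r\<close> by simp
      finally show ?thesis .
    qed (simp add: r_def)
    also have "\<dots> = (2 / kappa f * t) powr (real CARD('n) / 2)" by simp
    also have "\<dots> = (2 / kappa f) powr (real CARD('n) / 2) * t powr (real CARD('n) / 2)"
      by (rule powr_mult)
    finally show ?thesis .
  qed
  have "ennreal ((f a - \<delta>) * unit_ball_vol (real CARD('n)) * (2 / kappa f) powr (real CARD('n) / 2)
            * t powr (real CARD('n) / 2)) = ennreal (f a - \<delta>) * emeasure lborel (cball a r)"
    using r(1) t by (simp add: emeasure_cball ennreal_mult[symmetric] rd mult.assoc)
  also have "\<dots> = (\<integral>\<^sup>+x. ennreal (f a - \<delta>) * indicator (cball a r) x \<partial>lborel)"
    by (simp add: nn_integral_cmult_indicator)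
  also have "\<dots> \<le> (\<integral>\<^sup>+x. ennreal (f x) * indicator (cball a r) x \<partial>lborel)"
    using t low by (intro nn_integral_mono) (force simp: indicator_def intro!: ennreal_leI)
  finally show "ennreal ((f a - \<delta>) * unit_ball_vol (real CARD('n)) * (2 / kappa f) powr (real CARD('n) / 2)
            * t powr (real CARD('n) / 2))
          \<le> (\<integral>\<^sup>+x. ennreal (f x) * indicator (cball a r) x \<partial>lborel)" .
qed

section \<open>Moments from tail bounds\<close>

lemma (in sigma_finite_measure) nn_integral_layer_cake:
  assumes [measurable]: "Y \<in> borel_measurable M" and nn: "\<And>x. x \<in> space M \<Longrightarrow> 0 \<le> Y x"
  shows "(\<integral>\<^sup>+x. ennreal (Y x) \<partial>M) =
    (\<integral>\<^sup>+u. indicator {0..} u * emeasure M {x \<in> space M. u < Y x} \<partial>lborel)"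
proof -
  interpret pair_sigma_finite M "lborel :: real measure" ..
  have "(\<integral>\<^sup>+x. ennreal (Y x) \<partial>M) = (\<integral>\<^sup>+x. \<integral>\<^sup>+u. indicator {0..<Y x} u \<partial>lborel \<partial>M)"
    using nn by (intro nn_integral_cong) simp
  also have "\<dots> = (\<integral>\<^sup>+x. \<integral>\<^sup>+u. (if 0 \<le> u \<and> u < Y x then 1 else 0) \<partial>lborel \<partial>M)"
    by (intro nn_integral_cong) (auto simp: indicator_def)
  also have "\<dots> = (\<integral>\<^sup>+u. \<integral>\<^sup>+x. (if 0 \<le> u \<and> u < Y x then 1 else 0) \<partial>M \<partial>lborel)"
    by (rule Fubini'[symmetric]) measurable
  also have "\<dots> = (\<integral>\<^sup>+u. indicator {0..} u * emeasure M {x \<in> space M. u < Y x} \<partial>lborel)"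
  proof (intro nn_integral_cong)
    fix u :: real
    have "(\<integral>\<^sup>+x. (if 0 \<le> u \<and> u < Y x then 1 else 0) \<partial>M) =
        (\<integral>\<^sup>+x. indicator {0..} u * indicator {x \<in> space M. u < Y x} x \<partial>M)"
      by (intro nn_integral_cong) (auto simp: indicator_def)
    also have "\<dots> = indicator {0..} u * emeasure M {x \<in> space M. u < Y x}"
      by (subst nn_integral_cmult) auto
    finally show "(\<integral>\<^sup>+x. (if 0 \<le> u \<and> u < Y x then 1 else 0) \<partial>M) = \<dots>" .
  qed
  finally show ?thesis .
qed

text \<open>
  The integrand is the tail function of \<open>(S / c)\<^bsup>1/b\<^esup>\<close> for a standard exponential variable \<open>S\<close>, so the
  layer-cake formula turns the integral into the moment \<open>E (S / c)\<^bsup>1/b\<^esup>\<close>, which is a Gamma integral.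
\<close>

lemma nn_integral_exp_neg_powr:
  fixes c b :: real
  assumes c: "0 < c" and b: "0 < b"
  shows "(\<integral>\<^sup>+u. indicator {0..} u * ennreal (exp (- (c * u powr b))) \<partial>lborel)
    = ennreal (Gamma (1 / b + 1) * c powr (- (1 / b)))"
proof -
  \<comment> \<open>The exponential density vanishes on the negative half-line; truncating at 0 keeps the power
    well-behaved there.\<close>
  let ?M = "density lborel (exponential_density 1)"
  let ?Y = "\<lambda>s::real. (max 0 s / c) powr (1 / b)"
  interpret prob_space ?M
    by (rule prob_space_exponential_density) simp
  have D: "distributed ?M lborel (\<lambda>s. s) (exponential_density 1)"
    by (auto simp: distributed_def distr_id2 exponential_density_nonneg)
  have tail: "emeasure ?M {s \<in> space ?M. u < ?Y s} = ennreal (exp (- (c * u powr b)))" if u: "0 \<le> u" for u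
  proof -
    have iff: "u < ?Y s \<longleftrightarrow> c * u powr b < s" for s
    proof -
      have ub: "(u powr b) powr (1 / b) = u"
        using u b by (simp add: powr_powr)
      have "u < ?Y s \<longleftrightarrow> (u powr b) powr (1 / b) < ?Y s"
        by (simp add: ub)
      also have "\<dots> \<longleftrightarrow> u powr b < max 0 s / c"
      proof
        show "u powr b < max 0 s / c" if "(u powr b) powr (1 / b) < ?Y s"
        proof (rule ccontr)
          assume "\<not> u powr b < max 0 s / c"
          then have "?Y s \<le> (u powr b) powr (1 / b)"
            using b c by (intro powr_mono2) auto
          with that show False by simp
        qed
        show "(u powr b) powr (1 / b) < ?Y s" if "u powr b < max 0 s / c"
          using that b by (intro powr_less_mono2) auto
      qed
      also have "\<dots> \<longleftrightarrow> c * u powr b < s"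
        using c by (auto simp: pos_less_divide_eq mult.commute less_max_iff_disj mult_less_0_iff)
      finally show ?thesis .
    qed
    have "emeasure ?M {s \<in> space ?M. u < ?Y s} = prob {s \<in> space ?M. c * u powr b < s}"
      by (simp only: iff emeasure_eq_measure)
    also have "\<dots> = exp (- (c * u powr b) * 1)"
      using c exponential_distributedD_gt[OF D, of "c * u powr b"] by simp
    finally show ?thesis by simp
  qed
  have "(\<integral>\<^sup>+u. indicator {0..} u * ennreal (exp (- (c * u powr b))) \<partial>lborel) = (\<integral>\<^sup>+s. ennreal (?Y s) \<partial>?M)"
    by (subst nn_integral_layer_cake) (auto intro!: nn_integral_cong simp: tail[symmetric] indicator_def)
  also have "\<dots> = (\<integral>\<^sup>+s. ennreal (c powr (- (1 / b))) *
      ennreal (indicator {0..} s * s powr (1 / b + 1 - 1) / exp s) \<partial>lborel)"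
    using c by (subst nn_integral_density)
      (auto intro!: nn_integral_cong simp: exponential_density_def indicator_def ennreal_mult[symmetric]
         powr_divide powr_minus exp_minus field_simps)
  also have "\<dots> = ennreal (c powr (- (1 / b))) * ennreal (Gamma (1 / b + 1))"
    using b by (subst nn_integral_cmult) (auto simp: Gamma_conv_nn_integral_real add_pos_pos)
  also have "\<dots> = ennreal (Gamma (1 / b + 1) * c powr (- (1 / b)))"
    using b by (simp add: ennreal_mult[symmetric] Gamma_real_pos add_pos_pos less_imp_le mult.commute)
  finally show ?thesis .
qed

text \<open>
  A stretched-exponential tail up to an error \<open>\<epsilon>\<close>. Since \<open>Y\<close> is bounded by \<open>B\<close>, the error is integrated
  only over the levels of \<open>Y\<^bsup>p\<^esup>\<close>, which lie in \<open>[0, B\<^bsup>p\<^esup>]\<close>, and contributes at most \<open>B\<^bsup>p\<^esup> \<epsilon>\<close>.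
\<close>

lemma (in prob_space) moment_le_of_tail:
  fixes Y :: "'a \<Rightarrow> real"
  assumes [measurable]: "random_variable borel Y"
    and Y: "\<And>x. x \<in> space M \<Longrightarrow> 0 \<le> Y x" "\<And>x. x \<in> space M \<Longrightarrow> Y x \<le> B"
    and pos: "0 < c" "0 < a" "0 < p" "0 \<le> \<epsilon>" "0 \<le> B"
    and tail: "\<And>t. 0 \<le> t \<Longrightarrow> prob {x \<in> space M. t < Y x} \<le> exp (- (c * t powr a)) + \<epsilon>"
  shows "expectation (\<lambda>x. Y x powr p) \<le> Gamma (p / a + 1) * c powr (- (p / a)) + B powr p * \<epsilon>"
proof -
  have G: "0 \<le> Gamma (p / a + 1)"
    using pos by (intro less_imp_le Gamma_real_pos add_pos_pos) auto
  have Bp: "Y x powr p \<le> B powr p" if "x \<in> space M" for x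
    using Y[OF that] pos by (intro powr_mono2) auto
  have tl: "emeasure M {x \<in> space M. u < Y x powr p}
      \<le> ennreal (exp (- (c * u powr (a / p)))) + ennreal \<epsilon> * indicator {0..B powr p} u" if u: "0 \<le> u" for u
  proof (cases "u \<le> B powr p")
    case True
    have sub: "{x \<in> space M. u < Y x powr p} \<subseteq> {x \<in> space M. u powr (1 / p) < Y x}"
    proof safe
      fix x assume x: "x \<in> space M" "u < Y x powr p"
      then have "u powr (1 / p) < (Y x powr p) powr (1 / p)"
        using u pos by (intro powr_less_mono2) auto
      then show "u powr (1 / p) < Y x"
        using pos Y(1)[OF x(1)] by (simp add: powr_powr)
    qed
    have "emeasure M {x \<in> space M. u < Y x powr p} \<le> ennreal (prob {x \<in> space M. u powr (1 / p) < Y x})"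
      unfolding emeasure_eq_measure[symmetric] by (intro emeasure_mono sub) measurable
    also have "\<dots> \<le> ennreal (exp (- (c * (u powr (1 / p)) powr a)) + \<epsilon>)"
      by (intro ennreal_leI tail) simp
    finally show ?thesis
      using True u pos by (simp add: powr_powr)
  next
    case False
    then have "{x \<in> space M. u < Y x powr p} = {}"
      using Bp by force
    then show ?thesis by (simp only: emeasure_empty zero_le)
  qed
  have "(\<integral>\<^sup>+x. ennreal (Y x powr p) \<partial>M) =
    (\<integral>\<^sup>+u. indicator {0..} u * emeasure M {x \<in> space M. u < Y x powr p} \<partial>lborel)"
    by (rule nn_integral_layer_cake) auto
  also have "\<dots> \<le> (\<integral>\<^sup>+u. indicator {0..} u * ennreal (exp (- (c * u powr (a / p)))) +
      ennreal \<epsilon> * indicator {0..B powr p} u \<partial>lborel)"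
    using tl by (intro nn_integral_mono) (auto simp: indicator_def)
  also have "\<dots> = ennreal (Gamma (p / a + 1) * c powr (- (p / a))) + ennreal \<epsilon> * ennreal (B powr p)"
    using pos by (simp add: nn_integral_add nn_integral_exp_neg_powr nn_integral_cmult_indicator)
  also have "\<dots> = ennreal (Gamma (p / a + 1) * c powr (- (p / a)) + B powr p * \<epsilon>)"
    using pos by (simp add: G ennreal_mult[symmetric] ennreal_plus[symmetric] mult.commute del: ennreal_plus)
  finally have "(\<integral>\<^sup>+x. ennreal (Y x powr p) \<partial>M) \<le> \<dots>" .
  moreover have "integrable M (\<lambda>x. Y x powr p)"
    by (rule integrable_const_bound[where B = "B powr p"]) (use Bp in auto)
  ultimately show ?thesis
    using pos G by (simp add: nn_integral_eq_integral del: ennreal_plus)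
qed

section \<open>The gap between the sample maximum and the maximum\<close>

text \<open>
  The probability is a product of factors \<open>1 - P(X\<^sub>i \<in> S)\<close>, each at most \<open>1 - q \<le> exp (- q)\<close>.
\<close>

lemma (in prob_space) prob_all_avoid_le_exp:
  assumes I: "finite I" "I \<noteq> {}" and ind: "indep_vars (\<lambda>_. borel) X I"
    and S: "S \<in> sets borel" and q: "\<And>i. i \<in> I \<Longrightarrow> q \<le> prob (X i -` S \<inter> space M)"
  shows "prob {\<omega> \<in> space M. \<forall>i\<in>I. X i \<omega> \<notin> S} \<le> exp (- (real (card I) * q))"
proof -
  have rv: "random_variable borel (X i)" if "i \<in> I" for i
    using ind that by (simp add: indep_vars_def)
  have "{\<omega> \<in> space M. \<forall>i\<in>I. X i \<omega> \<notin> S} = (\<Inter>i\<in>I. X i -` (- S) \<inter> space M)"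
    using I(2) by auto
  then have "prob {\<omega> \<in> space M. \<forall>i\<in>I. X i \<omega> \<notin> S} = (\<Prod>i\<in>I. prob (X i -` (- S) \<inter> space M))"
    using indep_varsD_finite[OF ind I(2) I(1), of "\<lambda>_. - S"] S by simp
  also have "\<dots> \<le> (\<Prod>i\<in>I. exp (- q))"
  proof (intro prod_mono conjI measure_nonneg)
    fix i assume i: "i \<in> I"
    have "X i -` (- S) \<inter> space M = space M - X i -` S \<inter> space M"
      by auto
    then have "prob (X i -` (- S) \<inter> space M) = 1 - prob (X i -` S \<inter> space M)"
      using measurable_sets[OF rv[OF i] S] by (simp add: prob_compl)
    also have "\<dots> \<le> exp (- q)"
      using q[OF i] exp_ge_add_one_self[of "- q"] by linarith
    finally show "prob (X i -` (- S) \<inter> space M) \<le> exp (- q)" .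
  qed
  also have "\<dots> = exp (- (real (card I) * q))"
    by (simp add: exp_of_nat_mult[symmetric])
  finally show ?thesis .
qed

lemma sample_max_bounds:
  fixes f :: "'b \<Rightarrow> real" and X :: "nat \<Rightarrow> 'a \<Rightarrow> 'b"
  assumes "N \<ge> 1" "\<And>x. 0 \<le> f x" "\<And>x. f x \<le> f a"
  shows "0 \<le> (SUP n\<in>{1..N}. f (X n \<omega>))" "(SUP n\<in>{1..N}. f (X n \<omega>)) \<le> f a"
proof -
  show "(SUP n\<in>{1..N}. f (X n \<omega>)) \<le> f a"
    using assms by (intro cSUP_least) auto
  have "f (X 1 \<omega>) \<le> (SUP n\<in>{1..N}. f (X n \<omega>))"
    using assms by (intro cSUP_upper) auto
  with assms(2)[of "X 1 \<omega>"] show "0 \<le> (SUP n\<in>{1..N}. f (X n \<omega>))"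
    by linarith
qed

lemma (in prob_space) integrable_sample_max_gap_powr:
  fixes f :: "'b::topological_space \<Rightarrow> real" and X :: "nat \<Rightarrow> 'a \<Rightarrow> 'b"
  assumes N: "N \<ge> 1" and f: "f \<in> borel_measurable borel" "\<And>x. 0 \<le> f x" "\<And>x. f x \<le> f a"
    and X: "\<And>n. n \<in> {1..N} \<Longrightarrow> random_variable borel (X n)" and p: "0 \<le> p"
  shows "integrable M (\<lambda>\<omega>. \<bar>(SUP n\<in>{1..N}. f (X n \<omega>)) - f a\<bar> powr p)"
proof (rule integrable_const_bound[where B = "f a powr p"])
  show "AE \<omega> in M. norm (\<bar>(SUP n\<in>{1..N}. f (X n \<omega>)) - f a\<bar> powr p) \<le> f a powr p"
  proof (rule AE_I2)
    fix \<omega>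
    have "\<bar>(SUP n\<in>{1..N}. f (X n \<omega>)) - f a\<bar> \<le> f a"
      using sample_max_bounds[where N = N and f = f and a = a and X = X and \<omega> = \<omega>] N f by auto
    then show "norm (\<bar>(SUP n\<in>{1..N}. f (X n \<omega>)) - f a\<bar> powr p) \<le> f a powr p"
      using p by (auto intro!: powr_mono2)
  qed
  have [measurable]: "random_variable borel (\<lambda>\<omega>. f (X n \<omega>))" if "n \<in> {1..N}" for n
    using measurable_compose[OF X[OF that] f(1)] .
  show "(\<lambda>\<omega>. \<bar>(SUP n\<in>{1..N}. f (X n \<omega>)) - f a\<bar> powr p) \<in> borel_measurable M"
    by measurable
qed

text \<open>
  A gap larger than \<open>t \<le> \<delta>\<close> means that no sample point lies in the ball provided by
  \<open>superlevel_ball_mass\<close>. For \<open>t > \<delta>\<close> the tail is bounded by its value at \<open>\<delta>\<close>; that value serves as the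
  error term of \<open>moment_le_of_tail\<close>, with the gap bounded by \<open>f a\<close>.
\<close>

lemma (in prob_space) sample_max_gap_moment_le:
  fixes f :: "real ^ 'n::finite \<Rightarrow> real"
  defines "d \<equiv> real CARD('n)"
  assumes f: "C2_fun f" "bounded (range (hessian f))" "\<And>x. 0 \<le> f x" "\<And>x. f x \<le> f a"
    and k: "0 < kappa f" and \<delta>: "0 < \<delta>" "\<delta> < f a" and p: "0 < p" and N: "N \<ge> 1"
    and ind: "indep_vars (\<lambda>_. borel) X {1..N}"
    and distr: "\<And>n. n \<in> {1..N} \<Longrightarrow> distributed M lborel (X n) (\<lambda>x. ennreal (f x))"
  defines "c \<equiv> (f a - \<delta>) * unit_ball_vol d * (2 / kappa f) powr (d / 2)"
  shows "expectation (\<lambda>\<omega>. \<bar>(SUP n\<in>{1..N}. f (X n \<omega>)) - f a\<bar> powr p)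
    \<le> Gamma (2 * p / d + 1) * (real N * c) powr (- (2 * p / d))
       + f a powr p * exp (- (real N * (c * \<delta> powr (d / 2))))"
proof -
  define Y where "Y \<omega> = f a - (SUP n\<in>{1..N}. f (X n \<omega>))" for \<omega>
  have d: "0 < d" by (simp add: d_def)
  have c: "0 < c"
    using \<delta> d k by (auto simp: c_def intro!: mult_pos_pos)
  have Y: "0 \<le> Y \<omega>" "Y \<omega> \<le> f a" for \<omega>
    using sample_max_bounds[where N = N and f = f and a = a and X = X and \<omega> = \<omega>] N f by (auto simp: Y_def)
  have cont: "continuous_on UNIV f"
    using f(1) by (simp add: C2_fun_def C1_fun_continuous)
  have rv: "random_variable borel (X n)" if "n \<in> {1..N}" for n
    using ind that by (auto simp: indep_vars_def)
  have [measurable]: "random_variable borel (\<lambda>\<omega>. f (X n \<omega>))" if "n \<in> {1..N}" for n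
    using measurable_compose[OF rv[OF that] borel_measurable_continuous_onI[OF cont]] .
  have Ym[measurable]: "random_variable borel Y"
    unfolding Y_def by measurable
  have small: "prob {\<omega> \<in> space M. t < Y \<omega>} \<le> exp (- (real N * (c * t powr (d / 2))))"
    if t: "0 \<le> t" "t \<le> \<delta>" for t
  proof -
    define S where "S = cball a (sqrt (2 * t / kappa f))"
    note ball = superlevel_ball_mass[OF f(1,2,4) k t less_imp_le[OF \<delta>(2)], folded S_def d_def, folded c_def]
    have mass: "c * t powr (d / 2) \<le> prob (X n -` S \<inter> space M)" if n: "n \<in> {1..N}" for n
    proof -
      have "ennreal (c * t powr (d / 2)) \<le> emeasure M (X n -` S \<inter> space M)"
        using ball(2) distributed_emeasure[OF distr[OF n], of S] by (simp add: S_def)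
      then show ?thesis
        by (simp add: emeasure_eq_measure)
    qed
    have "prob {\<omega> \<in> space M. t < Y \<omega>} \<le> prob {\<omega> \<in> space M. \<forall>n\<in>{1..N}. X n \<omega> \<notin> S}"
    proof (rule finite_measure_mono)
      show "{\<omega> \<in> space M. t < Y \<omega>} \<subseteq> {\<omega> \<in> space M. \<forall>n\<in>{1..N}. X n \<omega> \<notin> S}"
      proof (safe)
        fix \<omega> n assume t: "t < Y \<omega>" and n: "n \<in> {1..N}" and "X n \<omega> \<in> S"
        then have "f a - t \<le> f (X n \<omega>)"
          using ball(1) by blast
        also have "\<dots> \<le> (SUP n\<in>{1..N}. f (X n \<omega>))"
          using n by (intro cSUP_upper) auto
        finally show False
          using t by (simp add: Y_def)
      qed
      have "{\<omega> \<in> space M. \<forall>n\<in>{1..N}. X n \<omega> \<notin> S} = space M - (\<Union>n\<in>{1..N}. X n -` S \<inter> space M)"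
        by auto
      also have "\<dots> \<in> events"
        by (intro sets.Diff sets.top sets.finite_UN finite_atLeastAtMost measurable_sets[OF rv]) (auto simp: S_def)
      finally show "{\<omega> \<in> space M. \<forall>n\<in>{1..N}. X n \<omega> \<notin> S} \<in> events" .
    qed
    also have "\<dots> \<le> exp (- (real (card {1..N}) * (c * t powr (d / 2))))"
      using N by (intro prob_all_avoid_le_exp ind mass) (auto simp: S_def)
    finally show ?thesis by simp
  qed
  have tail: "prob {\<omega> \<in> space M. t < Y \<omega>} \<le>
      exp (- (real N * c * t powr (d / 2))) + exp (- (real N * (c * \<delta> powr (d / 2))))"
    if t: "0 \<le> t" for t
  proof (cases "t \<le> \<delta>")
    case True
    with small[OF t True] show ?thesis
      by (simp add: mult.assoc add_increasing2)
  next
    case False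
    have "prob {\<omega> \<in> space M. t < Y \<omega>} \<le> prob {\<omega> \<in> space M. \<delta> < Y \<omega>}"
      using False by (intro finite_measure_mono) auto
    also have "\<dots> \<le> exp (- (real N * (c * \<delta> powr (d / 2))))"
      using \<delta> by (intro small) auto
    finally show ?thesis by (simp add: add_increasing)
  qed
  have "expectation (\<lambda>\<omega>. Y \<omega> powr p) \<le>
    Gamma (p / (d / 2) + 1) * (real N * c) powr (- (p / (d / 2)))
       + f a powr p * exp (- (real N * (c * \<delta> powr (d / 2))))"
    using N c d p Y \<delta> by (intro moment_le_of_tail tail Ym) auto
  moreover have "\<bar>(SUP n\<in>{1..N}. f (X n \<omega>)) - f a\<bar> = Y \<omega>" for \<omega>
    using Y[of \<omega>] by (simp add: Y_def)
  ultimately show ?thesis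
    by (simp add: mult.commute)
qed

section \<open>The asymptotic rate\<close>

text \<open>
  The error term is exponentially small in \<open>N\<close> for each fixed \<open>\<delta>\<close>, and the strict inequality assumed for the
  limiting constant leaves room to fix \<open>\<delta> > 0\<close> by continuity before letting \<open>N\<close> grow.
\<close>

lemma eventually_moment_le_of_family_bound:
  fixes E :: "nat \<Rightarrow> real"
  assumes m: "0 < m" and v: "0 < v"
    and bound: "\<And>\<delta> N. 0 < \<delta> \<Longrightarrow> \<delta> < m \<Longrightarrow> N \<ge> 1 \<Longrightarrow>
      E N \<le> G * (real N * ((m - \<delta>) * v)) powr (- e) + K * exp (- (real N * ((m - \<delta>) * v * \<delta> powr b)))"
    and C: "G * (m * v) powr (- e) < C"
  shows "eventually (\<lambda>N. real N powr e * E N < C) sequentially"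
proof -
  have "((\<lambda>\<delta>. G * ((m - \<delta>) * v) powr (- e)) \<longlongrightarrow> G * ((m - 0) * v) powr (- e)) (at_right 0)"
    using m v by (intro tendsto_intros) auto
  then have "eventually (\<lambda>\<delta>. G * ((m - \<delta>) * v) powr (- e) < C) (at_right 0)"
    using C by (intro order_tendstoD) auto
  moreover have "eventually (\<lambda>\<delta>. 0 < \<delta> \<and> \<delta> < m) (at_right 0)"
    using m by (auto simp: eventually_at_right_field)
  ultimately have "eventually (\<lambda>\<delta>. G * ((m - \<delta>) * v) powr (- e) < C \<and> 0 < \<delta> \<and> \<delta> < m) (at_right 0)"
    by (rule eventually_conj)
  then obtain \<delta> where \<delta>: "G * ((m - \<delta>) * v) powr (- e) < C" "0 < \<delta>" "\<delta> < m"
    using eventually_happens trivial_limit_at_right_real by blast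
  define h where "h = (m - \<delta>) * v * \<delta> powr b"
  have h: "0 < h" using \<delta> v by (simp add: h_def)
  have "((\<lambda>N::nat. real N powr e * exp (- (real N * h))) \<longlongrightarrow> 0) sequentially"
    using h by real_asymp
  then have "((\<lambda>N::nat. G * ((m - \<delta>) * v) powr (- e) + K * (real N powr e * exp (- (real N * h))))
      \<longlongrightarrow> G * ((m - \<delta>) * v) powr (- e) + K * 0) sequentially"
    by (intro tendsto_intros)
  then have "eventually (\<lambda>N::nat. G * ((m - \<delta>) * v) powr (- e) + K * (real N powr e * exp (- (real N * h))) < C) sequentially"
    using \<delta>(1) by (intro order_tendstoD) auto
  then show ?thesis
    using eventually_ge_at_top[of 1]
  proof eventually_elim
    case (elim N)
    then have N: "0 < real N" by simp
    have "real N powr e * E N \<le> real N powr e *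
        (G * (real N * ((m - \<delta>) * v)) powr (- e) + K * exp (- (real N * h)))"
      using bound[OF \<delta>(2,3), of N] elim(2) by (intro mult_left_mono) (auto simp: h_def)
    also have "(real N * ((m - \<delta>) * v)) powr (- e) = real N powr (- e) * ((m - \<delta>) * v) powr (- e)"
      by (rule powr_mult)
    also have "real N powr e * (G * (real N powr (- e) * ((m - \<delta>) * v) powr (- e)) + K * exp (- (real N * h))) =
        (real N powr e * real N powr (- e)) * (G * ((m - \<delta>) * v) powr (- e)) + K * (real N powr e * exp (- (real N * h)))"
      by (simp add: algebra_simps)
    also have "real N powr e * real N powr (- e) = 1"
      using N by (simp add: powr_minus)
    finally show ?case using elim(1) by simp
  qed
qed

lemma limsup_le_of_eventually_le:
  fixes u :: "nat \<Rightarrow> ereal"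
  assumes "\<And>D. D0 < D \<Longrightarrow> eventually (\<lambda>n. u n \<le> ereal D) sequentially"
  shows "limsup u \<le> ereal D0"
proof (rule ereal_le_epsilon2)
  show "limsup u \<le> ereal D0 + ereal e" if "0 < e" for e
    using assms[of "D0 + e"] that by (simp add: Limsup_bounded)
qed

text \<open>
  The limiting coefficient \<open>c\<close> of the tail exponent enters the two bounds as \<open>c\<^bsup>-2/d\<^esup>\<close> and \<open>1/c\<close>;
  inserting \<open>V\<^sub>d = \<pi>\<^bsup>d/2\<^esup> / \<Gamma>(d/2 + 1)\<close> gives the stated constants.
\<close>

lemma ball_constant_powr:
  assumes pos: "0 < d" "0 < m" "0 < k"
  defines "c \<equiv> m * (unit_ball_vol d * (2 / k) powr (d / 2))"
  shows "c powr (- (2 / d)) = Gamma (d / 2 + 1) powr (2 / d) * k / (2 * pi * m powr (2 / d))"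
    and "1 / c = (k / (2 * pi)) powr (d / 2) * Gamma (d / 2 + 1) / m"
proof -
  have G: "0 < Gamma (d / 2 + 1)"
    using pos by (intro Gamma_real_pos) (simp add: add_pos_pos)
  have c: "1 / c = (k / (2 * pi)) powr (d / 2) * (Gamma (d / 2 + 1) / m)"
    using pos G by (simp add: c_def unit_ball_vol_def powr_divide powr_mult field_simps)
  then show "1 / c = (k / (2 * pi)) powr (d / 2) * Gamma (d / 2 + 1) / m"
    by simp
  have "c powr (- (2 / d)) = (1 / c) powr (2 / d)"
    by (simp add: powr_minus powr_divide inverse_eq_divide)
  also have "\<dots> = k / (2 * pi) * (Gamma (d / 2 + 1) powr (2 / d) / m powr (2 / d))"
    unfolding c using pos by (simp add: powr_mult powr_powr powr_divide)
  finally show "c powr (- (2 / d)) = Gamma (d / 2 + 1) powr (2 / d) * k / (2 * pi * m powr (2 / d))"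
    by simp
qed

theorem theorem2p3:
  fixes f :: "real ^ 'n::finite \<Rightarrow> real"
    and M :: "nat \<Rightarrow> 'w measure"
    and X :: "nat \<Rightarrow> nat \<Rightarrow> 'w \<Rightarrow> real ^ 'n"
    and xstar :: "real ^ 'n"
  assumes f_nonneg: "\<And>x. 0 \<le> f x"
    and f_C2: "C2_fun f"
    and f_density: "(\<integral>\<^sup>+x. ennreal (f x) \<partial>lborel) = 1"
    and hessian_bounded: "bounded (range (hessian f))"
    and prob: "\<And>N. N \<ge> 1 \<Longrightarrow> prob_space (M N)"
    and indep: "\<And>N. N \<ge> 1 \<Longrightarrow> prob_space.indep_vars (M N) (\<lambda>_. borel) (X N) {1..N}"
    and distr: "\<And>N n. n \<in> {1..N} \<Longrightarrow> distributed (M N) lborel (X N n) (\<lambda>x. ennreal (f x))"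
    and max_point: "\<And>x. f x \<le> f xstar"
  shows "0 \<le> kappa f \<and>
    (\<forall>p\<ge>1.
      limsup (\<lambda>N. ereal (real N powr (2 / real CARD('n))) *
          Lp_norm (M N) p (\<lambda>\<omega>. (SUP n\<in>{1..N}. f (X N n \<omega>)) - f xstar))
      \<le> ereal (Gamma (2 * p / real CARD('n) + 1) powr (1 / p)
            * Gamma (real CARD('n) / 2 + 1) powr (2 / real CARD('n)) * kappa f
          / (2 * pi * f xstar powr (2 / real CARD('n))))) \<and>
    (CARD('n) \<ge> 2 \<longrightarrow>
      limsup (\<lambda>N. ereal (real N * prob_space.expectation (M N)
          (\<lambda>\<omega>. \<bar>(SUP n\<in>{1..N}. f (X N n \<omega>)) - f xstar\<bar> powr (real CARD('n) / 2))))
      \<le> ereal ((kappa f / (2 * pi)) powr (real CARD('n) / 2)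
          * Gamma (real CARD('n) / 2 + 1) / f xstar))"
proof -
  define d where "d = real CARD('n)"
  define E where "E p N = prob_space.expectation (M N)
      (\<lambda>\<omega>. \<bar>(SUP n\<in>{1..N}. f (X N n \<omega>)) - f xstar\<bar> powr p)" for p N
  define v where "v = unit_ball_vol d * (2 / kappa f) powr (d / 2)"
  have d: "0 < d" by (simp add: d_def)
  have k: "0 < kappa f"
    by (rule kappa_pos[OF f_C2 hessian_bounded max_point f_nonneg f_density])
  have m: "0 < f xstar"
    by (rule density_max_pos[OF f_nonneg f_density max_point])
  have v: "0 < v"
    using d k by (auto simp: v_def intro!: mult_pos_pos)
  have moment: "eventually (\<lambda>N. real N powr (2 * p / d) * E p N < C) sequentially"
    if p: "0 < p" and C: "Gamma (2 * p / d + 1) * (f xstar * v) powr (- (2 * p / d)) < C" for p C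
  proof (rule eventually_moment_le_of_family_bound[OF m v _ C])
    fix \<delta> :: real and N :: nat
    assume "0 < \<delta>" "\<delta> < f xstar" "N \<ge> 1"
    then show "E p N \<le> Gamma (2 * p / d + 1) * (real N * ((f xstar - \<delta>) * v)) powr (- (2 * p / d))
        + f xstar powr p * exp (- (real N * ((f xstar - \<delta>) * v * \<delta> powr (d / 2))))"
      using prob_space.sample_max_gap_moment_le[OF prob f_C2 hessian_bounded f_nonneg max_point k _ _ p _ indep distr,
          of N \<delta>]
      by (simp add: E_def v_def d_def mult.assoc)
  qed
  have Lp: "limsup (\<lambda>N. ereal (real N powr (2 / d)) *
          Lp_norm (M N) p (\<lambda>\<omega>. (SUP n\<in>{1..N}. f (X N n \<omega>)) - f xstar))
      \<le> ereal (Gamma (2 * p / d + 1) powr (1 / p) * (f xstar * v) powr (- (2 / d)))" if p: "p \<ge> 1" for p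
  proof (rule limsup_le_of_eventually_le)
    fix D assume D: "Gamma (2 * p / d + 1) powr (1 / p) * (f xstar * v) powr (- (2 / d)) < D"
    have G: "0 < Gamma (2 * p / d + 1)"
      using p d by (intro Gamma_real_pos add_pos_pos) auto
    have "(Gamma (2 * p / d + 1) powr (1 / p) * (f xstar * v) powr (- (2 / d))) powr p < D powr p"
      using p D by (intro powr_less_mono2) auto
    moreover have "(Gamma (2 * p / d + 1) powr (1 / p) * (f xstar * v) powr (- (2 / d))) powr p
        = Gamma (2 * p / d + 1) * (f xstar * v) powr (- (2 * p / d))"
      using p G by (simp add: powr_mult powr_powr mult.commute)
    ultimately have "eventually (\<lambda>N. real N powr (2 * p / d) * E p N < D powr p) sequentially"
      using p by (intro moment) auto
    then show "eventually (\<lambda>N. ereal (real N powr (2 / d)) *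
          Lp_norm (M N) p (\<lambda>\<omega>. (SUP n\<in>{1..N}. f (X N n \<omega>)) - f xstar) \<le> ereal D) sequentially"
      using eventually_ge_at_top[of 1]
    proof eventually_elim
      \<comment> \<open>The gap is bounded, hence integrable to every power, so the norm takes its finite branch.\<close>
      case (elim N)
      interpret prob_space "M N" by (rule prob[OF elim(2)])
      have "integrable (M N) (\<lambda>\<omega>. \<bar>(SUP n\<in>{1..N}. f (X N n \<omega>)) - f xstar\<bar> powr p)"
        using elim(2) f_nonneg max_point indep[OF elim(2)] f_C2 p
        by (intro integrable_sample_max_gap_powr borel_measurable_continuous_onI C1_fun_continuous)
          (auto simp: indep_vars_def C2_fun_def)
      then have "ereal (real N powr (2 / d)) *
          Lp_norm (M N) p (\<lambda>\<omega>. (SUP n\<in>{1..N}. f (X N n \<omega>)) - f xstar)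
          = ereal (real N powr (2 / d) * E p N powr (1 / p))"
        by (simp add: Lp_norm_def E_def)
      also have "real N powr (2 / d) * E p N powr (1 / p) = (real N powr (2 * p / d) * E p N) powr (1 / p)"
        using p by (simp add: powr_mult powr_powr)
      also have "\<dots> \<le> (D powr p) powr (1 / p)"
        using elim(1) p by (intro powr_mono2) (auto simp: E_def intro!: mult_nonneg_nonneg integral_nonneg_AE)
      also have "\<dots> = D"
      proof -
        have "0 \<le> D"
          using D by (smt (verit) mult_nonneg_nonneg powr_ge_zero)
        then show ?thesis using p by (simp add: powr_powr)
      qed
      finally show ?case by simp
    qed
  qed
  \<comment> \<open>The moment bound at \<open>p = d/2\<close>, where \<open>2p/d = 1\<close> and \<open>\<Gamma>(2) = 1\<close>.\<close>
  have mean: "limsup (\<lambda>N. ereal (real N * E (d / 2) N)) \<le> ereal (1 / (f xstar * v))"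
  proof (rule limsup_le_of_eventually_le)
    fix D assume "1 / (f xstar * v) < D"
    then have "eventually (\<lambda>N. real N powr (2 * (d / 2) / d) * E (d / 2) N < D) sequentially"
      using d m v Gamma_fact[of 1, where 'a = real] by (intro moment) (auto simp: powr_minus inverse_eq_divide)
    then show "eventually (\<lambda>N. ereal (real N * E (d / 2) N) \<le> ereal D) sequentially"
      by eventually_elim (use d in simp)
  qed
  show ?thesis
    using k Lp mean
    by (simp add: ball_constant_powr[OF d m k, folded v_def] E_def d_def[symmetric] mult.assoc)
qed

end
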